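(* For any integer $n\geq 0$, the Eulerian polynomial $A_{n+1}(x)$ equals the lower Hessenberg determinant of order $n+1$ $$A_{n+1}(x)=\det(m_{i,j})_{0\leq i,j\leq n},$$ where $m_{0,0}=x$, $m_{i,0}=A_i(x)$ for $1\leq i\leq n$, $m_{i,j}=\binom{i}{j-1}x(1-x)^{i-j}$ for $1\leq j\leq i\leq n$, $m_{i,i+1}=-1$ for $0\leq i\leq n-1$, and $m_{i,j}=0$ for $j>i+1$.
   Context: For $n\geq 1$ the Eulerian polynomial is $A_n(x)=\sum_{\pi\in\mathfrak{S}_n}x^{\mathrm{des}(\pi)+1}$, where $\mathfrak{S}_n$ is the symmetric group on $\{1,\ldots,n\}$ and $\mathrm{des}(\pi)$ is the number of $i\in\{1,\ldots,n-1\}$ with $\pi(i)>\pi(i+1)$. E.g. $A_1(x)=x$, $A_2(x)=x+x^2$, $A_3(x)=x+4x^2+x^3$. *)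

theory Defs
  imports
    "HOL-Computational_Algebra.Polynomial"
    "HOL-Combinatorics.Permutations"
    "Jordan_Normal_Form.Determinant"
begin

definition des :: "nat \<Rightarrow> (nat \<Rightarrow> nat) \<Rightarrow> nat" where
  "des n \<pi> = card {i \<in> {1..n - 1}. \<pi> i > \<pi> (i + 1)}"

text \<open>Only the values for \<open>n \<ge> 1\<close> are meaningful; the value at \<open>0\<close> is never used below.\<close>

definition eulerian_poly :: "nat \<Rightarrow> int poly" where
  "eulerian_poly n = (\<Sum>\<pi> | \<pi> permutes {1..n}. monom 1 (des n \<pi> + 1))"

text \<open>The indeterminate \<open>x\<close> is \<open>[:0, 1:]\<close>, so \<open>1 - x\<close> is \<open>[:1, -1:]\<close>.\<close>

definition eulerian_hessenberg_entry :: "nat \<Rightarrow> nat \<Rightarrow> int poly" where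
  "eulerian_hessenberg_entry i j =
     (if j = 0 then (if i = 0 then [:0, 1:] else eulerian_poly i)
      else if j \<le> i then of_nat (i choose (j - 1)) * [:0, 1:] * [:1, -1:] ^ (i - j)
      else if j = i + 1 then -1
      else 0)"

end

theory Submission
  imports
    Defs
    "HOL-Combinatorics.Multiset_Permutations"
    "HOL-Computational_Algebra.Polynomial_FPS"
begin

text \<open>
  Write \<open>A n\<close> for the Eulerian polynomial. The determinant only packages a linear recurrence.
  If a lower Hessenberg matrix \<open>a\<close> has \<open>-1\<close> along the superdiagonal, then row \<open>i\<close> says how to
  continue a sequence: \<open>D (i + 1) = \<Sum>j\<le>i. a i j * D j\<close>, with \<open>D 0 = 1\<close>. The vector
  \<open>(D 0, \<dots>, D n)\<close> is annihilated by every row except the last, which yields \<open>D (n + 1)\<close>, and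
  this value is the determinant (\<open>det_lower_hessenberg\<close>). For the matrix of the theorem,
  \<open>D = (1, A 1, A 2, \<dots>)\<close>, so the claim amounts to
  \[ A_{n+1} = A_n + \sum_{j=1}^{n} {n \choose j-1}\, x\, (1-x)^{n-j} A_j, \]
  which is \<open>eulerian_poly_recurrence\<close>.

  This recurrence is a shadow of the binomial theorem. By the classical identity
  \[ \sum_{m\ge 1} m^n x^m = \frac{A_n(x)}{(1-x)^{n+1}}, \]
  division by \<open>(1 - x) ^ (n + 1)\<close> turns it into an identity of power series whose coefficient
  at \<open>x ^ m\<close> reads
  \[ m^{n+1} - (m-1)^{n+1} = m^n + (m-1)\,(m^n - (m-1)^n), \]
  where the difference \<open>m ^ n - (m - 1) ^ n\<close> comes from expanding \<open>((m - 1) + 1) ^ n\<close> and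
  dropping the leading term.

  The classical identity follows by induction on \<open>n\<close> from
  \[ A_{n+1} = (n+1)\, x\, A_n + x (1-x) A_n', \]
  since the operator \<open>x * d/dx\<close> turns \<open>m ^ n\<close> into \<open>m ^ (n + 1)\<close>. The differential recurrence in
  turn counts how the number of descents of a permutation, written as a word, changes when a new
  largest letter is inserted (\<open>sum_descents_insert_at\<close>).

  The polynomial \<open>A 0\<close> obtained from the definition is \<open>x\<close>. With this value all the recurrences
  above start at \<open>n = 0\<close>, and the corner entry \<open>x\<close> of the matrix fits the pattern of its first
  column.
\<close>

section \<open>Descents of words\<close>

fun descents :: "'a :: linorder list \<Rightarrow> nat" where
  "descents (a # b # xs) = of_bool (a > b) + descents (b # xs)"
| "descents _ = 0"

lemma descents_snoc: "descents (xs @ [a, b]) = descents (xs @ [a]) + of_bool (a > b)"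
  by (induction xs rule: descents.induct) auto

lemma descents_map_upt: "descents (map f [1..<Suc n]) = des n f"
proof (induction n)
  case 0
  show ?case by (simp add: des_def)
next
  case (Suc n)
  show ?case
  proof (cases n)
    case 0
    then show ?thesis by (simp add: des_def)
  next
    case (Suc m)
    have "{i \<in> {1..n}. f i > f (i + 1)} =
        {i \<in> {1..n - 1}. f i > f (i + 1)} \<union> (if f n > f (Suc n) then {n} else {})"
      using Suc by (auto simp: le_Suc_eq)
    moreover have "card \<dots> = des n f + of_bool (f n > f (Suc n))"
      unfolding des_def using Suc by (auto simp: card_insert_if)
    moreover have "map f [1..<Suc (Suc n)] = map f [1..<n] @ [f n, f (Suc n)]"
      "map f [1..<Suc n] = map f [1..<n] @ [f n]"
      using Suc by simp_all
    ultimately show ?thesis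
      using Suc.IH by (simp add: des_def descents_snoc)
  qed
qed

text \<open>
  Surjectivity comes for free: both sets have \<open>n!\<close> elements. The same counting argument is used
  for \<open>bij_betw_insert_at\<close>.
\<close>

lemma bij_betw_permutes_permutations_of_set:
  "bij_betw (\<lambda>\<pi>. map \<pi> [1..<Suc n]) {\<pi>. \<pi> permutes {1..n}} (permutations_of_set {1..n})"
    (is "bij_betw ?w ?P ?L")
proof -
  have inj: "inj_on ?w ?P"
  proof (rule inj_onI)
    fix \<pi> \<sigma> assume *: "\<pi> \<in> ?P" "\<sigma> \<in> ?P" "?w \<pi> = ?w \<sigma>"
    have "\<pi> i = \<sigma> i" for i
    proof (cases "i \<in> {1..n}")
      case True
      then have "i \<in> set [1..<Suc n]" by auto
      then show ?thesis using *(3) map_eq_conv by metis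
    next
      case False
      then show ?thesis using *(1,2) by (metis mem_Collect_eq permutes_not_in)
    qed
    then show "\<pi> = \<sigma>" by blast
  qed
  have "?w ` ?P \<subseteq> ?L"
  proof safe
    fix \<pi> assume \<pi>: "\<pi> permutes {1..n}"
    have "set [1..<Suc n] = {1..n}" by auto
    then show "?w \<pi> \<in> ?L"
      using permutes_image[OF \<pi>] permutes_inj_on[OF \<pi>]
      by (intro permutations_of_setI) (simp_all only: set_map distinct_map distinct_upt simp_thms)
  qed
  moreover have "card (?w ` ?P) = card ?L"
    unfolding card_image[OF inj] by (simp add: card_permutations)
  ultimately have "?w ` ?P = ?L"
    by (intro card_subset_eq) simp_all
  with inj show ?thesis by (simp add: bij_betw_def)
qed

lemma eulerian_poly_eq_sum_lists:
  "eulerian_poly n = (\<Sum>xs \<in> permutations_of_set {1..n}. monom 1 (descents xs + 1))"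
  unfolding eulerian_poly_def
  by (subst sum.reindex_bij_betw[OF bij_betw_permutes_permutations_of_set, symmetric])
     (simp only: descents_map_upt)

section \<open>Inserting a new maximum\<close>

definition insert_at :: "'a \<Rightarrow> nat \<Rightarrow> 'a list \<Rightarrow> 'a list" where
  "insert_at a i xs = take i xs @ a # drop i xs"

lemma insert_at_simps [simp]:
  "insert_at a 0 xs = a # xs"
  "insert_at a i [] = [a]"
  "insert_at a (Suc i) (x # xs) = x # insert_at a i xs"
  by (simp_all add: insert_at_def)

lemma bij_betw_insert_at:
  assumes "finite A" "a \<notin> A"
  shows "bij_betw (\<lambda>(xs, i). insert_at a i xs)
           (permutations_of_set A \<times> {..card A}) (permutations_of_set (insert a A))"
    (is "bij_betw ?f ?P ?L")
proof -
  have len: "length xs = card A" "a \<notin> set xs" if "xs \<in> permutations_of_set A" for xs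
    using that assms by (auto simp: length_finite_permutations_of_set permutations_of_set_def)
  have inj: "inj_on ?f ?P"
  proof (rule inj_on_inverseI
      [where g = "\<lambda>ys. (remove1 a ys, length (takeWhile (\<lambda>y. y \<noteq> a) ys))"])
    fix p assume "p \<in> ?P"
    then obtain xs i
      where p: "p = (xs, i)" and *: "xs \<in> permutations_of_set A" "i \<in> {..card A}" by blast
    have "a \<notin> set (take i xs)" "a \<notin> set (drop i xs)"
      using len[OF *(1)] by (auto dest: in_set_takeD in_set_dropD)
    moreover from this have "takeWhile (\<lambda>y. y \<noteq> a) (take i xs @ a # drop i xs) = take i xs"
      by (auto simp: takeWhile_append)
    ultimately show "(remove1 a (?f p), length (takeWhile (\<lambda>y. y \<noteq> a) (?f p))) = p"
      using len[OF *(1)] *(2) by (simp add: p insert_at_def remove1_append)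
  qed
  have "?f ` ?P \<subseteq> ?L"
  proof (rule image_subsetI)
    fix p assume "p \<in> ?P"
    then obtain xs i where p: "p = (xs, i)" and *: "xs \<in> permutations_of_set A" by blast
    have "set (take i xs) \<union> set (drop i xs) = A"
      using *(1) by (metis append_take_drop_id permutations_of_setD(1) set_append)
    moreover have "set (take i xs) \<inter> set (drop i xs) = {}"
      using *(1) by (simp add: permutations_of_setD(2) set_take_disj_set_drop_if_distinct)
    ultimately show "?f p \<in> ?L"
      using permutations_of_setD(2)[OF *(1)] assms
      by (intro permutations_of_setI) (auto simp: p insert_at_def)
  qed
  moreover have "card (?f ` ?P) = card ?L"
    using assms by (simp add: card_image[OF inj] card_cartesian_product)
  ultimately have "?f ` ?P = ?L"
    using assms by (intro card_subset_eq) simp_all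
  with inj show ?thesis by (simp add: bij_betw_def)
qed

text \<open>
  Inserting a letter larger than all others into one of the \<open>length xs + 1\<close> gaps keeps the number
  of descents if the gap is a descent of \<open>xs\<close> or the end of the word, and creates one more descent
  in every other gap. The arbitrary weight \<open>g\<close> lets the induction absorb the descent that a letter
  put in front may contribute.
\<close>

lemma sum_descents_insert_at:
  fixes g :: "nat \<Rightarrow> 'b :: comm_ring_1"
  assumes "\<And>x. x \<in> set xs \<Longrightarrow> x < a"
  shows "(\<Sum>i\<le>length xs. g (descents (insert_at a i xs))) =
    of_nat (descents xs + 1) * g (descents xs) +
    (of_nat (length xs) - of_nat (descents xs)) * g (descents xs + 1)"
  using assms
proof (induction xs arbitrary: g rule: descents.induct)
  case (1 u v xs)
  let ?c = "of_bool (u > v) :: nat"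
  let ?h = "\<lambda>j. g (descents (u # insert_at a j (v # xs)))"
  let ?k = "\<lambda>j. g (?c + descents (insert_at a j (v # xs)))"
  have a: "\<not> a < u" "v < a" "\<not> a < v" using "1.prems" by force+
  have split: "(\<Sum>i\<le>length (u # v # xs). g (descents (insert_at a i (u # v # xs)))) =
      g (1 + descents (u # v # xs)) + (\<Sum>j\<le>length (v # xs). ?h j)"
    using "1.prems"
    by (simp only: length_Cons sum.atMost_Suc_shift) simp
  \<comment> \<open>Inserting behind \<open>u\<close> is inserting into the shorter word, shifted by the descent between
    \<open>u\<close> and \<open>v\<close>, except directly behind \<open>u\<close>, where that descent is destroyed.\<close>
  have h: "(\<Sum>j\<le>length (v # xs). ?h j) =
      ?h 0 - ?k 0 + (\<Sum>j\<le>length (v # xs). ?k j)"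
    by (simp only: length_Cons sum.atMost_Suc_shift) simp
  have k: "(\<Sum>j\<le>length (v # xs). ?k j) = of_nat (descents (v # xs) + 1) * g (?c + descents (v # xs)) +
    (of_nat (length (v # xs)) - of_nat (descents (v # xs))) * g (?c + (descents (v # xs) + 1))"
    using "1.prems" by (intro "1.IH") auto
  show ?case
    unfolding split h k using a by (simp add: algebra_simps del: sum.atMost_Suc)
qed auto

text \<open>
  A word with \<open>d\<close> descents has weight \<open>x ^ (d + 1)\<close>. The \<open>d + 1\<close> insertions that keep \<open>d\<close> and the
  \<open>n - d\<close> insertions that raise it give
  \<open>(d + 1) * x ^ (d + 1) + (n - d) * x ^ (d + 2)\<close>, which the right-hand side produces monomial by
  monomial.
\<close>

lemma eulerian_poly_Suc:
  "eulerian_poly (Suc n) = of_nat (Suc n) * [:0, 1:] * eulerian_poly n +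
     [:0, 1:] * [:1, -1:] * pderiv (eulerian_poly n)"
proof -
  let ?L = "permutations_of_set {1..n}"
  have "eulerian_poly (Suc n) =
      (\<Sum>(xs, i) \<in> ?L \<times> {..n}. monom 1 (descents (insert_at (Suc n) i xs) + 1))"
    using sum.reindex_bij_betw[OF bij_betw_insert_at[of "{1..n}" "Suc n"],
        of "\<lambda>ys. monom (1 :: int) (descents ys + 1)", symmetric]
    by (simp add: eulerian_poly_eq_sum_lists atLeastAtMostSuc_conv case_prod_unfold)
  also have "\<dots> = (\<Sum>xs\<in>?L. \<Sum>i\<le>n. monom 1 (descents (insert_at (Suc n) i xs) + 1))"
    by (simp add: sum.cartesian_product)
  also have "\<dots> = (\<Sum>xs\<in>?L. of_nat (Suc n) * [:0, 1:] * monom 1 (descents xs + 1) +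
      [:0, 1:] * [:1, -1:] * pderiv (monom 1 (descents xs + 1)))"
  proof (rule sum.cong[OF refl])
    fix xs assume xs: "xs \<in> ?L"
    then have len: "length xs = n"
      by (simp add: length_finite_permutations_of_set)
    let ?d = "descents xs"
    have "(\<Sum>i\<le>n. monom 1 (descents (insert_at (Suc n) i xs) + 1)) =
        of_nat (?d + 1) * monom 1 (?d + 1) + (of_nat n - of_nat ?d) * (monom 1 (?d + 2) :: int poly)"
      using sum_descents_insert_at[of xs "Suc n" "\<lambda>k. monom (1 :: int) (k + 1)"] xs
      by (auto simp: len permutations_of_set_def less_Suc_eq_le)
    also have "\<dots> = of_nat (Suc n) * [:0, 1:] * monom 1 (?d + 1) +
        [:0, 1:] * [:1, -1:] * pderiv (monom 1 (?d + 1))"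
    proof -
      have x: "[:0, 1:] = monom (1::int) 1" "[:1, -1:] = 1 - monom (1::int) 1"
        by (simp_all add: monom_altdef one_pCons)
      have p: "pderiv (monom 1 (?d + 1)) = of_nat (?d + 1) * monom (1::int) ?d"
        by (simp add: pderiv_monom of_nat_poly smult_monom)
      have m: "monom (1::int) (?d + 1) = monom 1 1 * monom 1 ?d"
        "monom (1::int) (?d + 2) = monom 1 1 * monom 1 1 * monom 1 ?d"
        by (simp_all add: mult_monom)
      show ?thesis unfolding p x unfolding m by (simp add: algebra_simps)
    qed
    finally show "(\<Sum>i\<le>n. monom 1 (descents (insert_at (Suc n) i xs) + 1)) = \<dots>" .
  qed
  also have "\<dots> = of_nat (Suc n) * [:0, 1:] * eulerian_poly n +
     [:0, 1:] * [:1, -1:] * pderiv (eulerian_poly n)"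
    by (simp only: eulerian_poly_eq_sum_lists sum.distrib sum_distrib_left
        higher_pderiv_sum[of 1, simplified])
  finally show ?thesis .
qed

lemma eulerian_poly_0: "eulerian_poly 0 = [:0, 1:]"
  by (simp add: eulerian_poly_def des_def monom_altdef)

section \<open>The generating series of the powers\<close>

lemma fps_of_poly_of_nat: "fps_of_poly (of_nat k) = of_nat k"
  by (simp add: of_nat_poly fps_of_poly_const fps_of_nat)

lemma fps_of_poly_1_minus_x: "fps_of_poly [:1, -1 :: 'a :: comm_ring_1:] = 1 - fps_X"
  by (simp add: fps_of_poly_pCons)

text \<open>
  The case distinction removes the constant term \<open>0 ^ 0 = 1\<close> at \<open>n = 0\<close>; otherwise
  \<open>(1 - x) * nat_power_series 0\<close> would be \<open>1\<close> instead of \<open>x = eulerian_poly 0\<close>.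
\<close>

definition nat_power_series :: "nat \<Rightarrow> int fps" where
  "nat_power_series n = Abs_fps (\<lambda>m. if m = 0 then 0 else of_nat m ^ n)"

text \<open>
  Apply \<open>x * d/dx\<close> to the series: it multiplies the coefficient at \<open>m\<close> by \<open>m\<close>, and by the product
  rule it acts on the numerator over \<open>(1 - x) ^ (n + 1)\<close> exactly as \<open>eulerian_poly_Suc\<close> prescribes.
  Multiplying by the power of \<open>1 - x\<close> instead of dividing keeps everything over the integers.
\<close>

lemma fps_of_eulerian_poly:
  "fps_of_poly (eulerian_poly n) = (1 - fps_X) ^ (n + 1) * nat_power_series n"
proof (induction n)
  case 0
  have "fps_X = (1 - fps_X) * nat_power_series 0"
    by (rule fps_ext) (auto simp: nat_power_series_def left_diff_distrib fps_X_nth)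
  then show ?case by (simp add: eulerian_poly_0 fps_of_poly_pCons)
next
  case (Suc n)
  have S: "nat_power_series (Suc n) = fps_X * fps_deriv (nat_power_series n)"
    by (rule fps_ext) (auto simp: nat_power_series_def)
  have "fps_of_poly (eulerian_poly (Suc n)) =
      of_nat (Suc n) * fps_X * fps_of_poly (eulerian_poly n) +
      fps_X * (1 - fps_X) * fps_deriv (fps_of_poly (eulerian_poly n))"
    by (simp only: eulerian_poly_Suc fps_of_poly_add fps_of_poly_mult fps_of_poly_fps_X
        fps_of_poly_1_minus_x fps_of_poly_pderiv fps_of_poly_of_nat)
  also have "\<dots> = (1 - fps_X) ^ (Suc n + 1) * nat_power_series (Suc n)"
  proof -
    have deriv: "fps_deriv ((1 - fps_X :: int fps) ^ (n + 1)) = - of_nat (Suc n) * (1 - fps_X) ^ n"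
      unfolding fps_deriv_power' by simp
    have "c * x * (y ^ (n + 1) * p) + x * y * (y ^ (n + 1) * p' + - c * y ^ n * p) =
        y ^ (Suc n + 1) * (x * p')" for c x y p p' :: "int fps"
      by (simp add: algebra_simps)
    then show ?thesis unfolding Suc.IH S fps_deriv_mult deriv .
  qed
  finally show ?case .
qed

text \<open>
  Both sides are \<open>(1 - x) ^ (n + 1)\<close> times a power series: \<open>A j\<close> carries the factor
  \<open>(1 - x) ^ (j + 1)\<close>, and the exponent \<open>n - j\<close> supplies what is missing. It remains to compare the
  two series coefficientwise.
\<close>

lemma eulerian_poly_recurrence:
  "eulerian_poly (Suc n) = eulerian_poly n +
     (\<Sum>j = 1..n. of_nat (n choose (j - 1)) * [:0, 1:] * [:1, -1:] ^ (n - j) * eulerian_poly j)"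
proof -
  let ?Y = "1 - fps_X :: int fps"
  have key: "?Y * nat_power_series (Suc n) =
      nat_power_series n + fps_X * (\<Sum>k<n. of_nat (n choose k) * nat_power_series (Suc k))"
  proof (rule fps_ext)
    fix m
    \<comment> \<open>The sum stops at \<open>k = n - 1\<close>, so the binomial theorem leaves out the term \<open>m ^ n\<close>.\<close>
    have "(\<Sum>k<n. int (n choose k) * int m ^ Suc k) = int m * ((int m + 1) ^ n - int m ^ n)" for m
    proof -
      have "(int m + 1) ^ n = (\<Sum>k<n. int (n choose k) * int m ^ k) + int m ^ n"
        by (simp add: binomial_ring lessThan_Suc_atMost[symmetric])
      then show ?thesis by (simp add: sum_distrib_left mult_ac)
    qed
    then show "fps_nth (?Y * nat_power_series (Suc n)) m =
        fps_nth (nat_power_series n + fps_X * (\<Sum>k<n. of_nat (n choose k) * nat_power_series (Suc k))) m"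
      by (cases m) (auto simp: nat_power_series_def left_diff_distrib fps_sum_nth algebra_simps
          fps_of_nat[symmetric])
  qed
  have summand: "fps_of_poly (of_nat (n choose k) * [:0, 1:] * [:1, -1:] ^ (n - Suc k) * eulerian_poly (Suc k)) =
      ?Y ^ (n + 1) * (fps_X * (of_nat (n choose k) * nat_power_series (Suc k)))" if "k < n" for k
  proof -
    have "n + 1 = (n - Suc k) + (Suc k + 1)" using that by simp
    then have "?Y ^ (n + 1) = ?Y ^ (n - Suc k) * ?Y ^ (Suc k + 1)" by (metis power_add)
    then show ?thesis
      by (simp only: fps_of_poly_mult fps_of_poly_power fps_of_poly_fps_X
          fps_of_poly_1_minus_x fps_of_eulerian_poly fps_of_poly_of_nat mult_ac)
  qed
  have "fps_of_poly (eulerian_poly (Suc n)) = ?Y ^ (n + 1) * (?Y * nat_power_series (Suc n))"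
    by (simp add: fps_of_eulerian_poly mult_ac)
  also have "\<dots> = fps_of_poly (eulerian_poly n) + (\<Sum>k<n.
      ?Y ^ (n + 1) * (fps_X * (of_nat (n choose k) * nat_power_series (Suc k))))"
    unfolding key by (simp only: fps_of_eulerian_poly distrib_left sum_distrib_left)
  also have "\<dots> = fps_of_poly (eulerian_poly n + (\<Sum>k<n.
      of_nat (n choose k) * [:0, 1:] * [:1, -1:] ^ (n - Suc k) * eulerian_poly (Suc k)))"
    by (simp only: fps_of_poly_add fps_of_poly_sum) (intro arg_cong2[of _ _ _ _ "(+)"] refl sum.cong, simp only: summand lessThan_iff)
  also have "(\<Sum>k<n. of_nat (n choose k) * [:0, 1:] * [:1, -1:] ^ (n - Suc k) * eulerian_poly (Suc k)) =
      (\<Sum>j = 1..n. of_nat (n choose (j - 1)) * [:0, 1:] * [:1, -1:] ^ (n - j) * eulerian_poly j)"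
    by (rule sum.reindex_bij_witness[of _ "\<lambda>j. j - 1" Suc]) auto
  finally show ?thesis by (simp only: fps_of_poly_eq_iff)
qed

section \<open>Determinants of lower Hessenberg matrices\<close>

text \<open>
  Column operations that replace the first column by \<open>\<Sum>j. D j * column j\<close> keep the determinant,
  because \<open>D 0 = 1\<close>. By the recurrence the new first column vanishes except for \<open>D (n + 1)\<close> in the
  last row. Expanding along it leaves a lower triangular minor with \<open>-1\<close> on the diagonal, whose
  determinant \<open>(-1) ^ n\<close> cancels the sign of the cofactor.
\<close>

lemma det_lower_hessenberg:
  fixes a :: "nat \<Rightarrow> nat \<Rightarrow> 'a :: idom"
  assumes super: "\<And>i. i < n \<Longrightarrow> a i (Suc i) = -1"
    and zero: "\<And>i j. Suc i < j \<Longrightarrow> j \<le> n \<Longrightarrow> a i j = 0"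
    and D0: "D 0 = 1"
    and D: "\<And>i. i \<le> n \<Longrightarrow> D (Suc i) = (\<Sum>j\<le>i. a i j * D j)"
  shows "det (mat (Suc n) (Suc n) (\<lambda>(i, j). a i j)) = D (Suc n)"
proof -
  \<comment> \<open>\<open>U\<close> performs the column operations and \<open>N\<close> is their result.\<close>
  define M where "M = mat (Suc n) (Suc n) (\<lambda>(i, j). a i j)"
  define U where "U = mat (Suc n) (Suc n) (\<lambda>(i, j). if j = 0 then D i else of_bool (i = j))"
  define N where "N = mat (Suc n) (Suc n)
    (\<lambda>(i, j). if j = 0 then (if i = n then D (Suc n) else 0) else a i j)"
  have row: "(\<Sum>j<Suc n. a i j * D j) = (if i = n then D (Suc n) else 0)" if "i \<le> n" for i
  proof (cases "i = n")
    case True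
    then show ?thesis using D[of n] by (simp add: lessThan_Suc_atMost)
  next
    case False
    with that have i: "i < n" by simp
    have "(\<Sum>j<Suc n. a i j * D j) = (\<Sum>j\<le>Suc i. a i j * D j)"
      using i by (intro sum.mono_neutral_right) (auto simp: zero)
    also have "\<dots> = 0" using i by (simp add: D super)
    finally show ?thesis using False by simp
  qed
  have "M * U = N"
  proof (rule eq_matI)
    fix i j assume ij: "i < dim_row N" "j < dim_col N"
    then have "(M * U) $$ (i, j) =
        (\<Sum>k<Suc n. a i k * (if j = 0 then D k else of_bool (k = j)))"
      by (simp add: M_def U_def N_def scalar_prod_def lessThan_atLeast0)
    also have "\<dots> = N $$ (i, j)"
    proof (cases "j = 0")
      case True
      then show ?thesis using ij row[of i] by (simp add: N_def)
    next
      case False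
      have "(\<Sum>k<Suc n. a i k * of_bool (k = j)) = (\<Sum>k<Suc n. if k = j then a i k else 0)"
        by (rule sum.cong) auto
      also have "\<dots> = a i j" using ij by (subst sum.delta) (auto simp: N_def)
      finally show ?thesis using ij False by (simp add: N_def)
    qed
    finally show "(M * U) $$ (i, j) = N $$ (i, j)" .
  qed (simp_all add: M_def U_def N_def)
  moreover have "det U = 1"
  proof -
    have "det U = prod_list (diag_mat U)"
      by (rule det_lower_triangular[of "Suc n"]) (auto simp: U_def)
    also have "diag_mat U = map (\<lambda>_. 1) [0..<Suc n]"
      by (auto simp: diag_mat_def U_def D0)
    finally show ?thesis by (simp add: map_replicate_const)
  qed
  ultimately have "det M = det N"
    using det_mult[of M "Suc n" U] by (simp add: M_def U_def)
  also have "det N = (\<Sum>i<Suc n. N $$ (i, 0) * cofactor N i 0)"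
    by (rule laplace_expansion_column) (auto simp: N_def)
  also have "\<dots> = D (Suc n) * cofactor N n 0"
    by (simp add: N_def)
  also have "cofactor N n 0 = 1"
  proof -
    have "det (mat_delete N n 0) = prod_list (diag_mat (mat_delete N n 0))"
      by (rule det_lower_triangular[of n]) (auto simp: N_def mat_delete_def zero)
    also have "diag_mat (mat_delete N n 0) = map (\<lambda>_. -1) [0..<n]"
      by (auto simp: diag_mat_def N_def mat_delete_def super)
    finally show ?thesis
      by (simp add: cofactor_def map_replicate_const flip: power_mult_distrib)
  qed
  finally show ?thesis by (simp add: M_def)
qed

section \<open>The Hessenberg determinant\<close>

theorem theorem5:
  fixes n :: nat
  shows "eulerian_poly (n + 1) =
    det (mat (n + 1) (n + 1) (\<lambda>(i, j). eulerian_hessenberg_entry i j))"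
proof -
  define D where "D i = (if i = 0 then 1 else eulerian_poly i)" for i
  have "D (Suc i) = (\<Sum>j\<le>i. eulerian_hessenberg_entry i j * D j)" for i
  proof -
    have "(\<Sum>j\<le>i. eulerian_hessenberg_entry i j * D j) =
        eulerian_poly i + (\<Sum>j = 1..i. eulerian_hessenberg_entry i j * D j)"
      by (simp add: atMost_atLeast0 sum.atLeast_Suc_atMost D_def eulerian_hessenberg_entry_def
          eulerian_poly_0)
    also have "\<dots> = eulerian_poly (Suc i)"
      unfolding eulerian_poly_recurrence
      by (intro arg_cong2[of _ _ _ _ "(+)"] refl sum.cong)
         (simp add: D_def eulerian_hessenberg_entry_def)
    finally show ?thesis by (simp add: D_def)
  qed
  then have "det (mat (Suc n) (Suc n) (\<lambda>(i, j). eulerian_hessenberg_entry i j)) = D (Suc n)"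
    by (intro det_lower_hessenberg) (auto simp: eulerian_hessenberg_entry_def D_def)
  then show ?thesis by (simp add: D_def)
qed

end
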